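(* Let $n\in\mathbb{N}$, $q_1,\ldots,q_n\in(0,1)$, and let $d\ge2$ be a finite integer. For each $c\in\mathbb{N}$ let $X_{j,k}^{(c)}\sim\mathrm{Geo}\bigl((1-d^{k-1-c})q_j\bigr)$, $1\le j\le n$, $1\le k\le c$, be independent over $j,k$, and let $Y_{n:n}^{(c)}=\max_{1\le j\le n}\sum_{k=1}^cX_{j,k}^{(c)}$. Then $\mathbb{E}[Y_{n:n}^{(c)}/c]$ is decreasing in $c$; that is, for every $c\in\mathbb{N}$, $$\frac1c\mathbb{E}[Y_{n:n}^{(c)}]>\frac1{c+1}\mathbb{E}[Y_{n:n}^{(c+1)}].$$
   Context: $\mathbb{N}=\{1,2,\ldots\}$. $\mathrm{Geo}(q)$ is the geometric distribution on $\{1,2,\ldots\}$ with $\mathbb{P}(X=k)=(1-q)^{k-1}q$. *)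

theory Defs
  imports "HOL-Probability.Probability"
begin

text \<open>The library's \<^const>\<open>geometric_pmf\<close> counts failures and so is supported on
  \<open>{0, 1, \<dots>}\<close>; the distribution on \<open>{1, 2, \<dots>}\<close> is its shift by one.\<close>

definition Geo :: "real \<Rightarrow> nat pmf" where
  "Geo q = map_pmf Suc (geometric_pmf q)"

lemma pmf_Geo:
  assumes "0 < q" "q \<le> 1" "1 \<le> k"
  shows "pmf (Geo q) k = (1 - q) ^ (k - 1) * q"
proof -
  obtain m where k: "k = Suc m"
    using assms(3) by (cases k) auto
  have "pmf (Geo q) (Suc m) = pmf (geometric_pmf q) m"
    unfolding Geo_def by (rule pmf_map_inj') simp
  then show ?thesis
    using assms k by simp
qed

definition max_of_sums :: "nat \<Rightarrow> nat \<Rightarrow> (nat \<Rightarrow> nat \<Rightarrow> 'a \<Rightarrow> nat) \<Rightarrow> 'a \<Rightarrow> real" where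
  "max_of_sums n c X \<omega> = real (MAX j\<in>{1..n}. \<Sum>k=1..c. X j k \<omega>)"

end

theory Submission
  imports Defs
begin

text \<open>On the probability space for \<open>c + 1\<close>, let \<open>T i\<close> be the maximum over \<open>j\<close> of the sums with the
  \<open>i\<close>-th summand left out. Summing over \<open>i\<close> shows that \<open>c\<close> times the maximum of the full sums is
  at most \<open>T 1 + \<dots> + T (c + 1)\<close>. The summand with \<open>k = 1\<close> has the largest success probability,
  hence is stochastically smallest, so leaving it out gives the largest expectation: this is seen
  on distribution functions, where independence turns the maximum into a product over \<open>j\<close> and the
  sum into a convolution. Finally \<open>T 1\<close> has the same law as the maximum for \<open>c\<close>, because the success
  probabilities depend only on \<open>k - c\<close>.\<close>

section \<open>Distribution function and integrability of the geometric law\<close>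

lemma prob_Geo_atMost:
  assumes "0 < a" "a \<le> 1"
  shows "measure_pmf.prob (Geo a) {..m} = 1 - (1 - a) ^ m"
proof (induction m)
  case 0
  have "set_pmf (Geo a) \<inter> {..0} = {}"
    by (auto simp: Geo_def)
  then have "measure_pmf.prob (Geo a) {..0} = 0"
    by (simp add: measure_pmf_zero_iff)
  then show ?case by simp
next
  case (Suc m)
  have "measure_pmf.prob (Geo a) {..Suc m} = measure_pmf.prob (Geo a) {..m} + pmf (Geo a) (Suc m)"
    by (simp add: measure_measure_pmf_finite)
  then show ?case
    using Suc assms by (simp add: pmf_Geo algebra_simps)
qed

lemma integrable_Geo:
  assumes "0 < a" "a \<le> 1"
  shows "integrable (measure_pmf (Geo a)) real"
proof -
  have "integrable (measure_pmf (geometric_pmf a)) (\<lambda>x. real x + 1)"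
    using integrable_real_geometric_pmf[of a] assms by auto
  then show ?thesis
    by (simp add: Geo_def map_pmf_rep_eq integrable_distr_eq add.commute)
qed

section \<open>Expectations and sums through distribution functions\<close>

text \<open>Tail-sum formula: sum and integral are interchanged for the nonnegative integral, and
  integrability brings the series back to the reals. Tails are written as complements of
  distribution functions because the latter factorise for a maximum.\<close>

lemma (in prob_space) tail_sums_expectation:
  fixes U :: "'a \<Rightarrow> nat"
  assumes "integrable M (\<lambda>\<omega>. real (U \<omega>))" and [measurable]: "U \<in> measurable M (count_space UNIV)"
  shows "(\<lambda>t. 1 - prob {\<omega> \<in> space M. U \<omega> \<le> t}) sums expectation (\<lambda>\<omega>. real (U \<omega>))"
proof -
  have tail: "1 - prob {\<omega> \<in> space M. U \<omega> \<le> t} = prob {\<omega> \<in> space M. t < U \<omega>}" for t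
    by (subst prob_neg[symmetric]) (auto simp: not_le)
  have "ennreal (expectation (\<lambda>\<omega>. real (U \<omega>))) = (\<integral>\<^sup>+\<omega>. of_nat (U \<omega>) \<partial>M)"
    using nn_integral_eq_integral[OF assms(1)] by (simp add: ennreal_of_nat_eq_real_of_nat)
  also have "\<dots> = (\<Sum>t. ennreal (prob {\<omega> \<in> space M. t < U \<omega>}))"
    by (simp add: nn_integral_nat_function emeasure_eq_measure)
  finally have "(\<lambda>t. ennreal (prob {\<omega> \<in> space M. t < U \<omega>})) sums ennreal (expectation (\<lambda>\<omega>. real (U \<omega>)))"
    using summable_sums[OF summableI[of "\<lambda>t. ennreal (prob {\<omega> \<in> space M. t < U \<omega>})"]] by simp
  then show ?thesis
    unfolding tail by (simp add: sums_ennreal)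
qed

text \<open>The difference of the two tail series has nonnegative terms, and the term at
  \<open>s\<close> is positive.\<close>

lemma (in prob_space) expectation_strict_mono_tail:
  fixes U V :: "'a \<Rightarrow> nat"
  assumes "integrable M (\<lambda>\<omega>. real (U \<omega>))" "integrable M (\<lambda>\<omega>. real (V \<omega>))"
    and "U \<in> measurable M (count_space UNIV)" "V \<in> measurable M (count_space UNIV)"
    and le: "\<And>t. prob {\<omega> \<in> space M. V \<omega> \<le> t} \<le> prob {\<omega> \<in> space M. U \<omega> \<le> t}"
    and less: "prob {\<omega> \<in> space M. V \<omega> \<le> s} < prob {\<omega> \<in> space M. U \<omega> \<le> s}"
  shows "expectation (\<lambda>\<omega>. real (U \<omega>)) < expectation (\<lambda>\<omega>. real (V \<omega>))"
proof -
  have "(\<lambda>t. prob {\<omega> \<in> space M. U \<omega> \<le> t} - prob {\<omega> \<in> space M. V \<omega> \<le> t})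
      sums (expectation (\<lambda>\<omega>. real (V \<omega>)) - expectation (\<lambda>\<omega>. real (U \<omega>)))"
    using sums_diff[OF tail_sums_expectation[OF assms(2,4)] tail_sums_expectation[OF assms(1,3)]]
    by simp
  from suminf_pos2[OF sums_summable[OF this], of s] sums_unique[OF this] show ?thesis
    using le less by simp
qed

text \<open>Split by the value \<open>w\<close> of \<open>W\<close>; values above \<open>t\<close>
  contribute nothing. The law of \<open>U\<close> enters only through its distribution function,
  with nonnegative weights, so comparisons of distribution functions pass to sums.\<close>

lemma (in prob_space) prob_add_le:
  fixes U W :: "'a \<Rightarrow> nat"
  assumes ind: "indep_var (count_space UNIV) W (count_space UNIV) U"
  shows "prob {\<omega> \<in> space M. W \<omega> + U \<omega> \<le> t} =
    (\<Sum>w\<le>t. prob {\<omega> \<in> space M. W \<omega> = w} * prob {\<omega> \<in> space M. U \<omega> \<le> t - w})"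
proof -
  have [measurable]: "W \<in> measurable M (count_space UNIV)" "U \<in> measurable M (count_space UNIV)"
    using indep_var_rv1[OF ind] indep_var_rv2[OF ind] by auto
  have "{\<omega> \<in> space M. W \<omega> + U \<omega> \<le> t} =
      (\<Union>w\<in>{..t}. {\<omega> \<in> space M. W \<omega> = w \<and> U \<omega> \<le> t - w})"
    by auto
  also have "prob \<dots> = (\<Sum>w\<le>t. prob {\<omega> \<in> space M. W \<omega> = w \<and> U \<omega> \<le> t - w})"
    by (rule finite_measure_finite_Union) (auto simp: disjoint_family_on_def)
  also have "\<dots> = (\<Sum>w\<le>t. prob {\<omega> \<in> space M. W \<omega> = w} * prob {\<omega> \<in> space M. U \<omega> \<le> t - w})"
  proof (rule sum.cong[OF refl])
    fix w
    show "prob {\<omega> \<in> space M. W \<omega> = w \<and> U \<omega> \<le> t - w} =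
        prob {\<omega> \<in> space M. W \<omega> = w} * prob {\<omega> \<in> space M. U \<omega> \<le> t - w}"
      using indep_varD[OF ind, of "{w}" "{..t - w}"]
      by (simp add: vimage_def Int_def conj_commute)
  qed
  finally show ?thesis .
qed

section \<open>Reindexing independent families and transfer between probability spaces\<close>

text \<open>Injectivity makes the blocks \<open>{h i}\<close> disjoint, so the restrictions to them
  are independent, and reading off the only coordinate of each block preserves this.\<close>

lemma (in prob_space) indep_vars_reindex:
  assumes ind: "indep_vars N X I" and h: "inj_on h J" "h ` J \<subseteq> I"
  shows "indep_vars (\<lambda>i. N (h i)) (\<lambda>i. X (h i)) J"
proof -
  have "indep_vars (\<lambda>i. PiM {h i} N) (\<lambda>i \<omega>. restrict (\<lambda>k. X k \<omega>) {h i}) J"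
    using h by (intro indep_vars_restrict[OF ind]) (auto simp: disjoint_family_on_def inj_on_def)
  then have "indep_vars (\<lambda>i. N (h i)) (\<lambda>i \<omega>. (\<lambda>f. f (h i)) (restrict (\<lambda>k. X k \<omega>) {h i})) J"
    by (rule indep_vars_compose2) auto
  then show ?thesis by simp
qed

text \<open>Independence makes each joint law the product of its marginals, so equal marginals give
  equal joint laws. The two spaces may differ, as needed to relate the unrelated spaces for
  \<open>c\<close> and \<open>c + 1\<close>.\<close>

lemma integral_eq_if_indep_same_distr:
  fixes f :: "('i \<Rightarrow> 'b) \<Rightarrow> real"
  assumes A: "prob_space A" and B: "prob_space B"
    and U: "prob_space.indep_vars A N U I" and V: "prob_space.indep_vars B N V I"
    and I: "I \<noteq> {}"
    and same: "\<And>i. i \<in> I \<Longrightarrow> distr A (N i) (U i) = distr B (N i) (V i)"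
    and f: "f \<in> borel_measurable (PiM I N)"
  shows "(\<integral>\<omega>. f (\<lambda>i\<in>I. U i \<omega>) \<partial>A) = (\<integral>\<omega>. f (\<lambda>i\<in>I. V i \<omega>) \<partial>B)"
proof -
  have rv: "U i \<in> measurable A (N i)" "V i \<in> measurable B (N i)" if "i \<in> I" for i
    using U V that prob_space.indep_vars_def[OF A] prob_space.indep_vars_def[OF B] by metis+
  have "distr A (PiM I N) (\<lambda>\<omega>. \<lambda>i\<in>I. U i \<omega>) = PiM I (\<lambda>i. distr A (N i) (U i))"
    using prob_space.indep_vars_iff_distr_eq_PiM'[OF A I rv(1)] U by auto
  also have "\<dots> = PiM I (\<lambda>i. distr B (N i) (V i))"
    by (rule PiM_cong) (auto simp: same)
  also have "\<dots> = distr B (PiM I N) (\<lambda>\<omega>. \<lambda>i\<in>I. V i \<omega>)"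
    using prob_space.indep_vars_iff_distr_eq_PiM'[OF B I rv(2)] V by auto
  finally have eq: "distr A (PiM I N) (\<lambda>\<omega>. \<lambda>i\<in>I. U i \<omega>) = distr B (PiM I N) (\<lambda>\<omega>. \<lambda>i\<in>I. V i \<omega>)" .
  have "(\<integral>\<omega>. f (\<lambda>i\<in>I. U i \<omega>) \<partial>A) = integral\<^sup>L (distr A (PiM I N) (\<lambda>\<omega>. \<lambda>i\<in>I. U i \<omega>)) f"
    by (intro integral_distr[symmetric] measurable_restrict rv f)
  also have "\<dots> = (\<integral>\<omega>. f (\<lambda>i\<in>I. V i \<omega>) \<partial>B)"
    unfolding eq by (intro integral_distr measurable_restrict rv f)
  finally show ?thesis .
qed

section \<open>Maxima of row sums and independence\<close>

lemma measurable_MAX_nat: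
  fixes f :: "'i \<Rightarrow> 'a \<Rightarrow> nat"
  assumes "finite J" "J \<noteq> {}" "\<And>j. j \<in> J \<Longrightarrow> f j \<in> measurable M (count_space UNIV)"
  shows "(\<lambda>\<omega>. MAX j\<in>J. f j \<omega>) \<in> measurable M (count_space UNIV)"
  using assms
proof (induction rule: finite_ne_induct)
  case (insert j J)
  then have [measurable]: "f j \<in> measurable M (count_space UNIV)"
    "(\<lambda>\<omega>. MAX j\<in>J. f j \<omega>) \<in> measurable M (count_space UNIV)"
    by auto
  have "(\<lambda>\<omega>. max (f j \<omega>) (MAX j\<in>J. f j \<omega>)) \<in> measurable M (count_space UNIV)"
    \<comment> \<open>The inner maximum takes countably many values, so it may be frozen at
      \<open>m\<close>.\<close>
    by (rule measurable_compose_countable[where f = "\<lambda>m \<omega>. max (f j \<omega>) m"]) measurable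
  then show ?case using insert by simp
qed simp

text \<open>The rows use the disjoint blocks \<open>{j} \<times> K\<close>, so the row sums are
  independent, and a maximum is at most \<open>t\<close> exactly when every row sum is.\<close>

lemma (in prob_space) prob_MAX_sum_le:
  fixes X :: "'i \<Rightarrow> 'k \<Rightarrow> 'a \<Rightarrow> nat"
  assumes ind: "indep_vars (\<lambda>_. count_space UNIV) (\<lambda>(j, k). X j k) (J \<times> K)"
    and J: "finite J" "J \<noteq> {}"
  shows "prob {\<omega> \<in> space M. (MAX j\<in>J. \<Sum>k\<in>K. X j k \<omega>) \<le> t} =
    (\<Prod>j\<in>J. prob {\<omega> \<in> space M. (\<Sum>k\<in>K. X j k \<omega>) \<le> t})"
proof -
  have "indep_vars (\<lambda>j. PiM ({j} \<times> K) (\<lambda>_. count_space UNIV))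
      (\<lambda>j \<omega>. restrict (\<lambda>i. (case i of (j, k) \<Rightarrow> X j k) \<omega>) ({j} \<times> K)) J"
    by (intro indep_vars_restrict[OF ind]) (auto simp: disjoint_family_on_def)
  then have "indep_vars (\<lambda>_. count_space UNIV)
      (\<lambda>j \<omega>. (\<lambda>f. \<Sum>k\<in>K. f (j, k)) (restrict (\<lambda>i. (case i of (j, k) \<Rightarrow> X j k) \<omega>) ({j} \<times> K))) J"
    by (rule indep_vars_compose2) auto
  then have ind': "indep_vars (\<lambda>_. count_space UNIV) (\<lambda>j \<omega>. \<Sum>k\<in>K. X j k \<omega>) J"
    by simp
  have "{\<omega> \<in> space M. (MAX j\<in>J. \<Sum>k\<in>K. X j k \<omega>) \<le> t} =
      (\<Inter>j\<in>J. (\<lambda>\<omega>. \<Sum>k\<in>K. X j k \<omega>) -` {..t} \<inter> space M)"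
    using J by auto
  also have "prob \<dots> = (\<Prod>j\<in>J. prob ((\<lambda>\<omega>. \<Sum>k\<in>K. X j k \<omega>) -` {..t} \<inter> space M))"
    using J by (intro indep_varsD_finite[OF ind']) auto
  finally show ?thesis
    by (simp add: vimage_def Int_def conj_commute)
qed

lemma (in prob_space) indep_var_sum_nat:
  fixes X :: "'k \<Rightarrow> 'a \<Rightarrow> nat"
  assumes ind: "indep_vars (\<lambda>_. count_space UNIV) X (insert i K)" and i: "i \<notin> K"
  shows "indep_var (count_space UNIV) (\<lambda>\<omega>. \<Sum>k\<in>K. X k \<omega>) (count_space UNIV) (X i)"
proof -
  have "indep_var (count_space UNIV) ((\<lambda>f. \<Sum>k\<in>K. f k) \<circ> (\<lambda>\<omega>. restrict (\<lambda>k. X k \<omega>) K))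
      (count_space UNIV) ((\<lambda>f. f i) \<circ> (\<lambda>\<omega>. restrict (\<lambda>k. X k \<omega>) {i}))"
    using i by (intro indep_var_compose[OF indep_var_restrict[OF ind]]) auto
  then show ?thesis by (simp add: comp_def)
qed


section \<open>Stochastic comparison of geometric summands\<close>

lemma (in prob_space) prob_le_if_distr_Geo:
  assumes U: "U \<in> measurable M (count_space UNIV)"
    and "distr M (count_space UNIV) U = measure_pmf (Geo a)" "0 < a" "a \<le> 1"
  shows "prob {\<omega> \<in> space M. U \<omega> \<le> m} = 1 - (1 - a) ^ m"
proof -
  have "prob {\<omega> \<in> space M. U \<omega> \<le> m} = measure (distr M (count_space UNIV) U) {..m}"
    using U by (subst measure_distr) (auto intro!: arg_cong[where f = prob])
  then show ?thesis
    using assms by (simp add: prob_Geo_atMost)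
qed

text \<open>The value \<open>1 - (1 - p) ^ m\<close> grows with \<open>p\<close>, and the
  convolution formula carries this over to the sum with \<open>W\<close>.\<close>

lemma (in prob_space) prob_add_Geo_le_mono:
  assumes ind: "indep_var (count_space UNIV) W (count_space UNIV) U"
      "indep_var (count_space UNIV) W (count_space UNIV) V"
    and distr: "distr M (count_space UNIV) U = measure_pmf (Geo a)"
      "distr M (count_space UNIV) V = measure_pmf (Geo b)"
    and ab: "0 < a" "a \<le> b" "b \<le> 1"
  shows "prob {\<omega> \<in> space M. W \<omega> + U \<omega> \<le> t} \<le> prob {\<omega> \<in> space M. W \<omega> + V \<omega> \<le> t}"
proof -
  have "prob {\<omega> \<in> space M. U \<omega> \<le> m} \<le> prob {\<omega> \<in> space M. V \<omega> \<le> m}" for m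
    using ab distr ind[THEN indep_var_rv2] by (simp add: prob_le_if_distr_Geo power_mono)
  then show ?thesis
    unfolding prob_add_le[OF ind(1)] prob_add_le[OF ind(2)]
    by (intro sum_mono mult_left_mono) auto
qed

text \<open>At \<open>Suc w\<close> the convolution term with index \<open>w\<close> compares the
  probabilities of being at most 1, which are \<open>a\<close> and \<open>b\<close>, and its weight
  is positive.\<close>

lemma (in prob_space) prob_add_Geo_le_strict_mono:
  assumes ind: "indep_var (count_space UNIV) W (count_space UNIV) U"
      "indep_var (count_space UNIV) W (count_space UNIV) V"
    and distr: "distr M (count_space UNIV) U = measure_pmf (Geo a)"
      "distr M (count_space UNIV) V = measure_pmf (Geo b)"
    and ab: "0 < a" "a < b" "b \<le> 1"
    and w: "0 < prob {\<omega> \<in> space M. W \<omega> = w}"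
  shows "prob {\<omega> \<in> space M. W \<omega> + U \<omega> \<le> Suc w} < prob {\<omega> \<in> space M. W \<omega> + V \<omega> \<le> Suc w}"
proof -
  have "prob {\<omega> \<in> space M. U \<omega> \<le> m} \<le> prob {\<omega> \<in> space M. V \<omega> \<le> m}" for m
    using ab distr ind[THEN indep_var_rv2] by (simp add: prob_le_if_distr_Geo power_mono)
  moreover have "prob {\<omega> \<in> space M. U \<omega> \<le> Suc w - w} < prob {\<omega> \<in> space M. V \<omega> \<le> Suc w - w}"
    using ab distr ind[THEN indep_var_rv2] by (simp add: prob_le_if_distr_Geo)
  ultimately show ?thesis
    unfolding prob_add_le[OF ind(1)] prob_add_le[OF ind(2)]
    using w by (intro sum_strict_mono_ex1) (auto intro!: mult_left_mono bexI[of _ w] mult_strict_left_mono)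
qed

lemma (in prob_space) integrable_if_distr_Geo:
  assumes "U \<in> measurable M (count_space UNIV)"
    and "distr M (count_space UNIV) U = measure_pmf (Geo a)" "0 < a" "a \<le> 1"
  shows "integrable M (\<lambda>\<omega>. real (U \<omega>))"
proof -
  have "integrable (distr M (count_space UNIV) U) real"
    using assms integrable_Geo by simp
  then show ?thesis
    using assms(1) by (simp add: integrable_distr_eq)
qed

text \<open>By independence all summands equal 1 simultaneously with positive probability. This
  supplies the positive weight for the strict comparison.\<close>

lemma (in prob_space) prob_sum_eq_card_pos:
  fixes X :: "'k \<Rightarrow> 'a \<Rightarrow> nat"
  assumes ind: "indep_vars (\<lambda>_. count_space UNIV) X K" and K: "finite K"
    and distr: "\<And>k. k \<in> K \<Longrightarrow> distr M (count_space UNIV) (X k) = measure_pmf (Geo (a k))"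
    and a: "\<And>k. k \<in> K \<Longrightarrow> 0 < a k \<and> a k \<le> 1"
  shows "0 < prob {\<omega> \<in> space M. (\<Sum>k\<in>K. X k \<omega>) = card K}"
\<comment> \<open>The empty case does occur: for \<open>c = 1\<close> nothing remains once two of
  the two summands are removed. It is separate because an intersection over the empty family would
  be \<open>UNIV\<close> instead of the sample space.\<close>
proof (cases "K = {}")
  case True
  then show ?thesis by (simp add: prob_space)
next
  case False
  have rv[measurable]: "X k \<in> measurable M (count_space UNIV)" if "k \<in> K" for k
    using ind that unfolding indep_vars_def by auto
  have "prob (X k -` {1} \<inter> space M) = a k" if k: "k \<in> K" for k
    using distr[OF k] a[OF k] rv[OF k] measure_distr[of "X k" M "count_space UNIV" "{1}"]
    by (simp add: pmf_Geo measure_pmf_single)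
  then have "0 < (\<Prod>k\<in>K. prob (X k -` {1} \<inter> space M))"
    using a by (intro prod_pos) auto
  also have "\<dots> = prob (\<Inter>k\<in>K. X k -` {1} \<inter> space M)"
    using K False by (intro indep_varsD_finite[OF ind, symmetric]) auto
  also have "\<dots> \<le> prob {\<omega> \<in> space M. (\<Sum>k\<in>K. X k \<omega>) = card K}"
    using False by (intro finite_measure_mono) auto
  finally show ?thesis .
qed

section \<open>Integrability of the maximum and the pointwise leave-one-out bound\<close>

lemma (in prob_space) integrable_MAX_sum:
  fixes X :: "'i \<Rightarrow> 'k \<Rightarrow> 'a \<Rightarrow> nat"
  assumes J: "finite J" "J \<noteq> {}"
    and rv: "\<And>j k. j \<in> J \<Longrightarrow> k \<in> K \<Longrightarrow> X j k \<in> measurable M (count_space UNIV)"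
    and int: "\<And>j k. j \<in> J \<Longrightarrow> k \<in> K \<Longrightarrow> integrable M (\<lambda>\<omega>. real (X j k \<omega>))"
  shows "integrable M (\<lambda>\<omega>. real (MAX j\<in>J. \<Sum>k\<in>K. X j k \<omega>))"
proof (rule Bochner_Integration.integrable_bound)
  show "integrable M (\<lambda>\<omega>. \<Sum>j\<in>J. \<Sum>k\<in>K. real (X j k \<omega>))"
    using int by auto
  have "(\<lambda>\<omega>. MAX j\<in>J. \<Sum>k\<in>K. X j k \<omega>) \<in> measurable M (count_space UNIV)"
    using J rv by (intro measurable_MAX_nat measurable_sum_nat) auto
  then show "(\<lambda>\<omega>. real (MAX j\<in>J. \<Sum>k\<in>K. X j k \<omega>)) \<in> borel_measurable M"
    by measurable
  have "(MAX j\<in>J. \<Sum>k\<in>K. X j k \<omega>) \<le> (\<Sum>j\<in>J. \<Sum>k\<in>K. X j k \<omega>)" for \<omega>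
    using J by (auto intro!: member_le_sum)
  then have "real (MAX j\<in>J. \<Sum>k\<in>K. X j k \<omega>) \<le> (\<Sum>j\<in>J. \<Sum>k\<in>K. real (X j k \<omega>))" for \<omega>
    by (simp flip: of_nat_sum)
  then show "AE \<omega> in M. norm (real (MAX j\<in>J. \<Sum>k\<in>K. X j k \<omega>))
      \<le> norm (\<Sum>j\<in>J. \<Sum>k\<in>K. real (X j k \<omega>))"
    by (intro AE_I2) (simp add: abs_of_nonneg sum_nonneg)
qed

text \<open>Fix a row attaining the full maximum. Over all \<open>i\<close>, each of its entries is
  omitted exactly once, and each shortened sum of this row is below the corresponding
  maximum.\<close>

lemma card_mult_MAX_sum_le:
  fixes x :: "'i \<Rightarrow> 'k \<Rightarrow> nat"
  assumes J: "finite J" "J \<noteq> {}" and K: "finite K"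
  shows "(card K - 1) * (MAX j\<in>J. \<Sum>k\<in>K. x j k) \<le> (\<Sum>i\<in>K. MAX j\<in>J. \<Sum>k\<in>K - {i}. x j k)"
proof -
  have "(MAX j\<in>J. \<Sum>k\<in>K. x j k) \<in> (\<lambda>j. \<Sum>k\<in>K. x j k) ` J"
    using J by (intro Max_in) auto
  then obtain j where j: "j \<in> J" and eq: "(MAX j\<in>J. \<Sum>k\<in>K. x j k) = (\<Sum>k\<in>K. x j k)"
    by blast
  \<comment> \<open>Counting additively keeps the truncated subtraction in \<open>card K - 1\<close>
    out of the way until the end.\<close>
  have "(\<Sum>i\<in>K. \<Sum>k\<in>K - {i}. x j k) + (\<Sum>i\<in>K. x j i) = (\<Sum>i\<in>K. (\<Sum>k\<in>K - {i}. x j k) + x j i)"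
    by (simp add: sum.distrib)
  also have "\<dots> = (\<Sum>i\<in>K. \<Sum>k\<in>K. x j k)"
    using K by (intro sum.cong) (auto simp: sum.remove)
  finally have "(card K - 1) * (\<Sum>k\<in>K. x j k) = (\<Sum>i\<in>K. \<Sum>k\<in>K - {i}. x j k)"
    by (simp add: diff_mult_distrib)
  also have "\<dots> \<le> (\<Sum>i\<in>K. MAX j\<in>J. \<Sum>k\<in>K - {i}. x j k)"
    using J j by (intro sum_mono Max_ge) auto
  finally show ?thesis by (simp add: eq)
qed

section \<open>Which omitted summand gives the largest expectation\<close>

text \<open>In each row the two shortened sums share the part over \<open>K - {i, m}\<close>; one
  adds \<open>X j m\<close>, the other \<open>X j i\<close>. Since \<open>a j i < a j m\<close>, the
  former is stochastically smaller, and multiplying distribution functions over the rows gives the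
  comparison of maxima.\<close>

lemma (in prob_space) expectation_MAX_sum_leave_one_out:
  fixes X :: "'i \<Rightarrow> 'k \<Rightarrow> 'a \<Rightarrow> nat"
  assumes J: "finite J" "J \<noteq> {}" and K: "finite K" and i: "i \<in> K" and m: "m \<in> K"
    and ind: "indep_vars (\<lambda>_. count_space UNIV) (\<lambda>(j, k). X j k) (J \<times> K)"
    and distr: "\<And>j k. j \<in> J \<Longrightarrow> k \<in> K \<Longrightarrow>
      distr M (count_space UNIV) (X j k) = measure_pmf (Geo (a j k))"
    and a: "\<And>j k. j \<in> J \<Longrightarrow> k \<in> K \<Longrightarrow> 0 < a j k \<and> a j k \<le> 1"
    and less: "\<And>j. j \<in> J \<Longrightarrow> i \<noteq> m \<Longrightarrow> a j i < a j m"
  shows "expectation (\<lambda>\<omega>. real (MAX j\<in>J. \<Sum>k\<in>K - {i}. X j k \<omega>))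
      \<le> expectation (\<lambda>\<omega>. real (MAX j\<in>J. \<Sum>k\<in>K - {m}. X j k \<omega>))" (is ?weak)
    and "i \<noteq> m \<Longrightarrow> expectation (\<lambda>\<omega>. real (MAX j\<in>J. \<Sum>k\<in>K - {i}. X j k \<omega>))
      < expectation (\<lambda>\<omega>. real (MAX j\<in>J. \<Sum>k\<in>K - {m}. X j k \<omega>))"
proof -
  show strict: "expectation (\<lambda>\<omega>. real (MAX j\<in>J. \<Sum>k\<in>K - {i}. X j k \<omega>))
      < expectation (\<lambda>\<omega>. real (MAX j\<in>J. \<Sum>k\<in>K - {m}. X j k \<omega>))" if "i \<noteq> m"
  proof -
    define L where "L = K - {i, m}"
    have L: "finite L" "i \<notin> L" "m \<notin> L" "K - {i} = insert m L" "K - {m} = insert i L" "L \<subseteq> K"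
      using K i m that by (auto simp: L_def)
    have rv: "X j k \<in> measurable M (count_space UNIV)" if "j \<in> J" "k \<in> K" for j k
      using ind that unfolding indep_vars_def by auto
    have int: "integrable M (\<lambda>\<omega>. real (X j k \<omega>))" if "j \<in> J" "k \<in> K" for j k
      using integrable_if_distr_Geo[OF rv distr] a that by blast
    have indj: "indep_vars (\<lambda>_. count_space UNIV) (X j) N" if "j \<in> J" "N \<subseteq> K" for j N
      using indep_vars_reindex[OF ind, of "Pair j" N] that by (auto simp: inj_on_def)
    define W where "W j \<omega> = (\<Sum>k\<in>L. X j k \<omega>)" for j \<omega>
    have indW: "indep_var (count_space UNIV) (W j) (count_space UNIV) (X j k)"
      if "j \<in> J" "k \<in> K" "k \<notin> L" for j k
      unfolding W_def using indj[of j "insert k L"] L that by (intro indep_var_sum_nat) auto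
    have Wpos: "0 < prob {\<omega> \<in> space M. W j \<omega> = card L}" if "j \<in> J" for j
      unfolding W_def using that L distr a
      by (intro prob_sum_eq_card_pos[where a = "a j"] indj) auto
    have sums: "(\<Sum>k\<in>K - {i}. X j k \<omega>) = W j \<omega> + X j m \<omega>"
        "(\<Sum>k\<in>K - {m}. X j k \<omega>) = W j \<omega> + X j i \<omega>" for j \<omega>
      using L by (simp_all add: W_def)
    have sub: "indep_vars (\<lambda>_. count_space UNIV) (\<lambda>(j, k). X j k) (J \<times> (K - {k}))" for k
      by (rule indep_vars_subset[OF ind]) auto
    have le: "prob {\<omega> \<in> space M. W j \<omega> + X j i \<omega> \<le> t} \<le> prob {\<omega> \<in> space M. W j \<omega> + X j m \<omega> \<le> t}"
      if j: "j \<in> J" for j t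
      using prob_add_Geo_le_mono[OF indW[OF j i] indW[OF j m] distr[OF j i] distr[OF j m]]
        a[OF j i] a[OF j m] less[OF j \<open>i \<noteq> m\<close>] L by simp
    have lt: "prob {\<omega> \<in> space M. W j \<omega> + X j i \<omega> \<le> Suc (card L)}
        < prob {\<omega> \<in> space M. W j \<omega> + X j m \<omega> \<le> Suc (card L)}"
      if j: "j \<in> J" for j
      using prob_add_Geo_le_strict_mono[OF indW[OF j i] indW[OF j m] distr[OF j i] distr[OF j m]]
        a[OF j i] a[OF j m] less[OF j \<open>i \<noteq> m\<close>] L Wpos[OF j] by simp
    have prob_MAX:
        "prob {\<omega> \<in> space M. (MAX j\<in>J. W j \<omega> + X j m \<omega>) \<le> t} =
          (\<Prod>j\<in>J. prob {\<omega> \<in> space M. W j \<omega> + X j m \<omega> \<le> t})"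
        "prob {\<omega> \<in> space M. (MAX j\<in>J. W j \<omega> + X j i \<omega>) \<le> t} =
          (\<Prod>j\<in>J. prob {\<omega> \<in> space M. W j \<omega> + X j i \<omega> \<le> t})" for t
      using prob_MAX_sum_le[OF sub[of i] J, of t] prob_MAX_sum_le[OF sub[of m] J, of t]
      by (simp_all only: sums)
    obtain j0 where j0: "j0 \<in> J" using J by auto
    \<comment> \<open>One strict factor makes a product strictly larger only if the larger factors
      are all positive.\<close>
    have lt0: "0 < prob {\<omega> \<in> space M. W j \<omega> + X j m \<omega> \<le> Suc (card L)}" if "j \<in> J" for j
      using lt[OF that] measure_nonneg by (rule le_less_trans[rotated])
    show ?thesis
    \<comment> \<open>Up to null sets \<open>Suc (card L)\<close> is the least value of every
      shortened row sum. It does not depend on \<open>j\<close>, so one \<open>s\<close> serves all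
      rows.\<close>
    proof (rule expectation_strict_mono_tail[where s = "Suc (card L)"])
      fix t
      show "prob {\<omega> \<in> space M. (MAX j\<in>J. \<Sum>k\<in>K - {m}. X j k \<omega>) \<le> t}
          \<le> prob {\<omega> \<in> space M. (MAX j\<in>J. \<Sum>k\<in>K - {i}. X j k \<omega>) \<le> t}"
        unfolding sums prob_MAX by (intro prod_mono) (auto simp: le)
      show "prob {\<omega> \<in> space M. (MAX j\<in>J. \<Sum>k\<in>K - {m}. X j k \<omega>) \<le> Suc (card L)}
          < prob {\<omega> \<in> space M. (MAX j\<in>J. \<Sum>k\<in>K - {i}. X j k \<omega>) \<le> Suc (card L)}"
        unfolding sums prob_MAX
        by (rule prod_mono_strict[of j0]) (auto simp: J j0 lt lt0 le)
    qed (use J rv int in \<open>auto intro!: integrable_MAX_sum measurable_MAX_nat measurable_sum_nat\<close>)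
  qed
  show ?weak
    using strict by (cases "i = m") auto
qed

section \<open>Monotonicity in \<open>c\<close> for the given success probabilities\<close>

theorem proposition17:
  fixes n d :: nat and q :: "nat \<Rightarrow> real"
    and M :: "nat \<Rightarrow> 'a measure"
    and X :: "nat \<Rightarrow> nat \<Rightarrow> nat \<Rightarrow> 'a \<Rightarrow> nat"
  assumes "n \<ge> 1"
    and "\<And>j. j \<in> {1..n} \<Longrightarrow> 0 < q j \<and> q j < 1"
    and "d \<ge> 2"
    and "\<And>c. c \<ge> 1 \<Longrightarrow> prob_space (M c)"
    and "\<And>c. c \<ge> 1 \<Longrightarrow>
      prob_space.indep_vars (M c) (\<lambda>_. count_space UNIV) (\<lambda>(j, k). X c j k) ({1..n} \<times> {1..c})"
    and "\<And>c j k. c \<ge> 1 \<Longrightarrow> j \<in> {1..n} \<Longrightarrow> k \<in> {1..c} \<Longrightarrow>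
      distr (M c) (count_space UNIV) (X c j k) =
        measure_pmf (Geo ((1 - real d powi (int k - 1 - int c)) * q j))"
  shows "\<forall>c\<ge>1. 1 / real c * prob_space.expectation (M c) (max_of_sums n c (X c))
    > 1 / real (c + 1) * prob_space.expectation (M (c + 1)) (max_of_sums n (c + 1) (X (c + 1)))"
proof (intro allI impI)
  fix c :: nat
  assume c: "c \<ge> 1"
  define J K where "J = {1..n}" and "K = {1..Suc c}"
  have J: "finite J" "J \<noteq> {}" and K: "finite K" "1 \<in> K" "2 \<in> K" "card K = Suc c"
    using assms(1) c by (auto simp: J_def K_def)
  define Z where "Z = X (Suc c)"
  interpret prob_space "M (Suc c)"
    using assms(4) by simp
  define a where "a j k = (1 - real d powi (int k - 1 - int (Suc c))) * q j" for j k
  have ind: "indep_vars (\<lambda>_. count_space UNIV) (\<lambda>(j, k). Z j k) (J \<times> K)"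
    using assms(5)[of "Suc c"] by (simp add: J_def K_def Z_def)
  have distr: "distr (M (Suc c)) (count_space UNIV) (Z j k) = measure_pmf (Geo (a j k))"
    if "j \<in> J" "k \<in> K" for j k
    using assms(6)[of "Suc c" j k] that unfolding J_def K_def Z_def a_def by simp
  have pw: "0 < real d powi e" "e < 0 \<Longrightarrow> real d powi e < 1" for e
    using assms(3) power_int_strict_increasing[of e 0 "real d"] by auto
  \<comment> \<open>For \<open>k \<le> Suc c\<close> the exponent is at most -1, so the power of
    \<open>d\<close> lies strictly between 0 and 1.\<close>
  have a: "0 < a j k \<and> a j k \<le> 1" if "j \<in> J" "k \<in> K" for j k
  proof -
    have "0 < real d powi (int k - 1 - int (Suc c))" "real d powi (int k - 1 - int (Suc c)) < 1"
      using that by (auto simp: K_def intro!: pw)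
    moreover have "0 < q j" "q j < 1"
      using assms(2) that by (auto simp: J_def)
    ultimately show ?thesis
      unfolding a_def by (auto intro!: mult_pos_pos mult_le_one)
  qed
  \<comment> \<open>The power of \<open>d\<close> increases with \<open>k\<close> because
    \<open>d > 1\<close>, so the success probability is largest at \<open>k = 1\<close>.\<close>
  have less: "a j k < a j 1" if "j \<in> J" "k \<in> K" "k \<noteq> 1" for j k
    using assms(2)[of j] assms(3) that unfolding a_def J_def K_def
    by (auto intro!: mult_strict_right_mono power_int_strict_increasing)
  have rv: "Z j k \<in> measurable (M (Suc c)) (count_space UNIV)" if "j \<in> J" "k \<in> K" for j k
    using ind that unfolding indep_vars_def by auto
  have int: "integrable (M (Suc c)) (\<lambda>\<omega>. real (Z j k \<omega>))" if "j \<in> J" "k \<in> K" for j k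
    using integrable_if_distr_Geo[OF rv distr] a that by blast
  define T where "T i \<omega> = real (MAX j\<in>J. \<Sum>k\<in>K - {i}. Z j k \<omega>)" for i \<omega>
  have intT: "integrable (M (Suc c)) (T i)" for i
    unfolding T_def using J rv int by (intro integrable_MAX_sum) auto
  have T_le: "expectation (T i) \<le> expectation (T 1)" if "i \<in> K" for i
    unfolding T_def
    by (rule expectation_MAX_sum_leave_one_out(1)[OF J K(1) that K(2) ind distr a less[OF _ that]])
  \<comment> \<open>The index 2 lies in \<open>K\<close> because \<open>c \<ge> 1\<close>; this one
    strict comparison makes the final inequality strict.\<close>
  have T_less: "expectation (T 2) < expectation (T 1)"
    unfolding T_def
    by (rule expectation_MAX_sum_leave_one_out(2)[OF J K(1,3,2) ind distr a less[OF _ K(3)]]) auto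

  have "expectation (T 1) = prob_space.expectation (M c) (max_of_sums n c (X c))"
  proof -
    let ?f = "\<lambda>x. real (MAX j\<in>J. \<Sum>k=1..c. x (j, k))"
    \<comment> \<open>Leaving out \<open>k = 1\<close> leaves the indices from 2 to
      \<open>Suc c\<close>. Shifting them down by one is compatible with the laws, as the exponent
      depends only on the difference of \<open>k\<close> and \<open>c\<close>.\<close>
    let ?h = "\<lambda>(j, k). (j, Suc k)"
    have "indep_vars (\<lambda>_. count_space UNIV) (\<lambda>i. (\<lambda>(j, k). Z j k) (?h i)) (J \<times> {1..c})"
      by (rule indep_vars_reindex[OF ind]) (auto simp: inj_on_def K_def)
    then have indZ: "indep_vars (\<lambda>_. count_space UNIV) (\<lambda>(j, k). Z j (Suc k)) (J \<times> {1..c})"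
      by (simp add: case_prod_unfold)
    \<comment> \<open>Both maxima are written as the same function \<open>?f\<close> of a family
      restricted to \<open>J \<times> {1..c}\<close>; \<open>?f\<close> reads no coordinate outside
      this set.\<close>
    have "max_of_sums n c (X c) = (\<lambda>\<omega>. ?f (\<lambda>i\<in>J \<times> {1..c}. (\<lambda>(j, k). X c j k) i \<omega>))"
      by (auto simp: max_of_sums_def J_def intro!: arg_cong[where f = Max] image_cong)
    moreover have "T 1 = (\<lambda>\<omega>. ?f (\<lambda>i\<in>J \<times> {1..c}. (\<lambda>(j, k). Z j (Suc k)) i \<omega>))"
    proof -
      have "K - {1} = {Suc 1..Suc c}" by (auto simp: K_def)
      then have "(\<Sum>k\<in>K - {1}. Z j k \<omega>) = (\<Sum>k=1..c. Z j (Suc k) \<omega>)" for j \<omega>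
        by (simp only: sum.shift_bounds_cl_Suc_ivl)
      then show ?thesis
        by (auto simp: T_def intro!: arg_cong[where f = Max] image_cong)
    qed
    moreover have "(\<integral>\<omega>. ?f (\<lambda>i\<in>J \<times> {1..c}. (\<lambda>(j, k). Z j (Suc k)) i \<omega>) \<partial>M (Suc c)) =
        (\<integral>\<omega>. ?f (\<lambda>i\<in>J \<times> {1..c}. (\<lambda>(j, k). X c j k) i \<omega>) \<partial>M c)"
    proof (rule integral_eq_if_indep_same_distr[OF prob_space_axioms assms(4)[OF c] indZ])
      show "prob_space.indep_vars (M c) (\<lambda>_. count_space UNIV) (\<lambda>(j, k). X c j k) (J \<times> {1..c})"
        using assms(5)[OF c] by (simp add: J_def)
      show "J \<times> {1..c} \<noteq> {}"
        using J c by auto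
      show "distr (M (Suc c)) (count_space UNIV) ((\<lambda>(j, k). Z j (Suc k)) i) =
          distr (M c) (count_space UNIV) ((\<lambda>(j, k). X c j k) i)" if "i \<in> J \<times> {1..c}" for i
        using that distr[of "fst i" "Suc (snd i)"] assms(6)[OF c, of "fst i" "snd i"]
        by (auto simp: J_def K_def a_def diff_diff_eq)
      have "(\<lambda>x. MAX j\<in>J. \<Sum>k=1..c. x (j, k) :: nat) \<in>
          measurable (PiM (J \<times> {1..c}) (\<lambda>_. count_space UNIV)) (count_space UNIV)"
        using J by (intro measurable_MAX_nat measurable_sum_nat measurable_component_singleton) auto
      then show "?f \<in> borel_measurable (PiM (J \<times> {1..c}) (\<lambda>_. count_space UNIV))"
        by measurable
    qed
    ultimately show ?thesis by simp
  qed
  \<comment> \<open>The claim multiplied by \<open>c\<close> and \<open>Suc c\<close>, with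
    \<open>T 1\<close> in place of the maximum for \<open>c\<close>.\<close>
  moreover have "real c * expectation (max_of_sums n (Suc c) Z) < real (Suc c) * expectation (T 1)"
  proof -
    have Y: "max_of_sums n (Suc c) Z = (\<lambda>\<omega>. real (MAX j\<in>J. \<Sum>k\<in>K. Z j k \<omega>))"
      by (auto simp: max_of_sums_def J_def K_def)
    have "real c * max_of_sums n (Suc c) Z \<omega> \<le> (\<Sum>i\<in>K. T i \<omega>)" for \<omega>
      using card_mult_MAX_sum_le[OF J K(1), of "\<lambda>j k. Z j k \<omega>"] K(4)
      unfolding Y T_def by (simp flip: of_nat_mult of_nat_sum)
    then have "expectation (\<lambda>\<omega>. real c * max_of_sums n (Suc c) Z \<omega>) \<le> expectation (\<lambda>\<omega>. \<Sum>i\<in>K. T i \<omega>)"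
      using intT J rv int unfolding Y
      by (intro integral_mono integrable_mult_right integrable_MAX_sum Bochner_Integration.integrable_sum) auto
    also have "\<dots> = (\<Sum>i\<in>K. expectation (T i))"
      using intT by (simp add: Bochner_Integration.integral_sum)
    also have "\<dots> < (\<Sum>i\<in>K. expectation (T 1))"
      using K T_le T_less by (intro sum_strict_mono_ex1) auto
    finally show ?thesis
      using K by simp
  qed
  ultimately show "1 / real c * prob_space.expectation (M c) (max_of_sums n c (X c))
    > 1 / real (c + 1) * prob_space.expectation (M (c + 1)) (max_of_sums n (c + 1) (X (c + 1)))"
    using c by (simp add: Z_def field_simps)
qed

end
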